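(* Let $(X,\|\cdot\|)$ be a real normed space, $X\ne\{0\}$. Suppose that $b:X\to(-\infty,\infty]$ is convex and lower semicontinuous on $X$, continuous on $\mathrm{dom}(b)$, and Gâteaux differentiable in $U:=\mathrm{Int}(\mathrm{dom}(b))$, which is assumed to be nonempty. Suppose further that $b$ is uniformly convex on all nonempty, bounded and convex subsets of $\mathrm{dom}(b)$, that $b'$ is uniformly continuous on all nonempty, bounded and convex subsets of $U$, and that for each $x\in\mathrm{dom}(b)$ there exists $r_x\ge0$ such that $b$ is uniformly convex relative to $(\{x\},U\cap\{w\in X:\|w\|\ge r_x\})$ with a gauge $\psi_x$ satisfying $\lim_{t\to\infty}\psi_x(t)=\infty$. Then $b$ is a sequentially consistent Bregman function. If, in addition, $b'$ is weak-to-weak$^*$ sequentially continuous on $U$, then $b$ satisfies the limiting difference property.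
   Context: $X^*$ is the dual of $X$ and $\langle x^*,x\rangle:=x^*(x)$. $\mathrm{dom}(b):=\{x\in X:b(x)<\infty\}$. $b$ is Gâteaux differentiable at $x\in\mathrm{Int}(\mathrm{dom}(b))$ if there is $b'(x)\in X^*$ with $\langle b'(x),y\rangle=\lim_{t\to0}(b(x+ty)-b(x))/t$ for all $y\in X$. Uniform continuity of $b':U\to X^*$ is with respect to the norms. Relative uniform convexity: for convex $b$ and nonempty $S_1,S_2\subseteq\mathrm{dom}(b)$, $b$ is uniformly convex relative to $(S_1,S_2)$ if there is $\psi:[0,\infty)\to[0,\infty]$ (a relative gauge) with $\psi(t)>0$ for $t>0$ such that $b(\lambda x+(1-\lambda)y)+\lambda(1-\lambda)\psi(\|x-y\|)\le\lambda b(x)+(1-\lambda)b(y)$ for all $\lambda\in(0,1)$, $(x,y)\in S_1\times S_2$. (The sets $S_1,S_2$ are nonempty as part of the definition.) If $S_1=S_2=S$, $b$ is uniformly convex on $S$. Divergence: $B(x,y):=b(x)-b(y)-\langle b'(y),x-y\rangle$ for $(x,y)\in\mathrm{dom}(b)\times U$, and $B(x,y):=\infty$ otherwise, $(x,y)\in X^2$. Bregman function: $b$ is a Bregman function with zone $U$ if: (i) $U=\mathrm{Int}(\mathrm{dom}(b))\ne\emptyset$ and $b$ is Gâteaux differentiable in $U$; (ii) $b$ is convex and lower semicontinuous on $X$ and strictly convex on $\mathrm{dom}(b)$; (iii) for each $\gamma\in\mathbb R$ and $x\in\mathrm{dom}(b)$ the set $\{y\in U:B(x,y)\le\gamma\}$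 is bounded; (iv) if $x\in\mathrm{dom}(b)$ and $(y_i)$ in $U$ satisfy $\|x-y_i\|\to0$, then $B(x,y_i)\to0$; (v) if $(x_i)$ is a bounded sequence in $\mathrm{dom}(b)$, $(y_i)$ is a sequence in $U$, $B(x_i,y_i)\to0$ and $\|y_i-y\|\to0$ for some $y\in\mathrm{dom}(b)$, then $\|x_i-y\|\to0$. $b$ has the limiting difference property if for each $x\in\mathrm{dom}(b)$ and each sequence $(y_i)$ in $U$ converging weakly to some $y\in U$, $B(x,y)=\lim_{i\to\infty}(B(x,y_i)-B(y,y_i))$. $b$ is sequentially consistent if for all sequences $(x_i)$ in $\mathrm{dom}(b)$ and $(y_i)$ in $U$ with $(y_i)$ bounded and $B(x_i,y_i)\to0$ one has $\|x_i-y_i\|\to0$. $f:V\to X^*$ is weak-to-weak$^*$ sequentially continuous on $V\subseteq X$ if whenever $x_i\in V$ converges weakly to $x\in V$, $\langle f(x_i),z\rangle\to\langle f(x),z\rangle$ for all $z\in X$. *)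

theory Defs
  imports "HOL-Analysis.Analysis"
begin

text \<open>
  The dual of the normed space \<open>'a\<close> is \<open>'a \<Rightarrow>\<^sub>L real\<close>, with the operator norm. A function
  \<open>b : X \<rightarrow> (-\<infinity>, \<infinity>]\<close> is a total function into \<open>ereal\<close>; that it omits \<open>-\<infinity>\<close> is not built
  into the definitions below and has to be assumed where they are used. Under that assumption
  no sum or difference below is of the form \<open>\<infinity> - \<infinity>\<close>.
\<close>

definition edom :: "('a \<Rightarrow> ereal) \<Rightarrow> 'a set" where
  "edom b = {x. b x < \<infinity>}"

definition econvex :: "('a::real_vector \<Rightarrow> ereal) \<Rightarrow> bool" where
  "econvex b \<longleftrightarrow> (\<forall>x y. \<forall>u\<in>{0<..<1::real}.
     b (u *\<^sub>R x + (1 - u) *\<^sub>R y) \<le> ereal u * b x + ereal (1 - u) * b y)"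

definition strictly_econvex_on :: "'a::real_vector set \<Rightarrow> ('a \<Rightarrow> ereal) \<Rightarrow> bool" where
  "strictly_econvex_on S b \<longleftrightarrow> (\<forall>x\<in>S. \<forall>y\<in>S. \<forall>u\<in>{0<..<1::real}. x \<noteq> y \<longrightarrow>
     b (u *\<^sub>R x + (1 - u) *\<^sub>R y) < ereal u * b x + ereal (1 - u) * b y)"

definition lower_semicontinuous :: "('a::topological_space \<Rightarrow> ereal) \<Rightarrow> bool" where
  "lower_semicontinuous b \<longleftrightarrow> (\<forall>x. b x \<le> Liminf (at x) b)"

definition has_gateaux_deriv ::
  "('a::real_normed_vector \<Rightarrow> ereal) \<Rightarrow> ('a \<Rightarrow>\<^sub>L real) \<Rightarrow> 'a \<Rightarrow> bool" where
  "has_gateaux_deriv b l x \<longleftrightarrow> x \<in> interior (edom b) \<and>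
     (\<forall>y. ((\<lambda>t. (b (x + t *\<^sub>R y) - b x) / ereal t) \<longlongrightarrow> ereal (blinfun_apply l y)) (at 0))"

definition gateaux_differentiable :: "('a::real_normed_vector \<Rightarrow> ereal) \<Rightarrow> 'a \<Rightarrow> bool" where
  "gateaux_differentiable b x \<longleftrightarrow> (\<exists>l. has_gateaux_deriv b l x)"

definition gateaux_deriv :: "('a::real_normed_vector \<Rightarrow> ereal) \<Rightarrow> 'a \<Rightarrow> ('a \<Rightarrow>\<^sub>L real)" where
  "gateaux_deriv b x = (THE l. has_gateaux_deriv b l x)"

lemma has_gateaux_deriv_unique:
  assumes "has_gateaux_deriv b l x" "has_gateaux_deriv b m x"
  shows "l = m"
proof (rule blinfun_eqI)
  fix y
  let ?q = "\<lambda>t. (b (x + t *\<^sub>R y) - b x) / ereal t"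
  have "(?q \<longlongrightarrow> ereal (blinfun_apply l y)) (at 0)" "(?q \<longlongrightarrow> ereal (blinfun_apply m y)) (at 0)"
    using assms unfolding has_gateaux_deriv_def by blast+
  then have "ereal (blinfun_apply l y) = ereal (blinfun_apply m y)"
    by (rule tendsto_unique[OF at_neq_bot])
  then show "blinfun_apply l y = blinfun_apply m y" by simp
qed

lemma gateaux_deriv_eqI: "has_gateaux_deriv b l x \<Longrightarrow> gateaux_deriv b x = l"
  unfolding gateaux_deriv_def by (blast intro: has_gateaux_deriv_unique)

text \<open>Only the values of a gauge on \<open>[0, \<infinity>)\<close> matter.\<close>

definition relative_gauge ::
  "('a::real_normed_vector \<Rightarrow> ereal) \<Rightarrow> 'a set \<Rightarrow> 'a set \<Rightarrow> (real \<Rightarrow> ereal) \<Rightarrow> bool" where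
  "relative_gauge b S1 S2 \<psi> \<longleftrightarrow> (\<forall>t\<ge>0. 0 \<le> \<psi> t) \<and> (\<forall>t>0. 0 < \<psi> t) \<and>
     (\<forall>u\<in>{0<..<1::real}. \<forall>x\<in>S1. \<forall>y\<in>S2.
        b (u *\<^sub>R x + (1 - u) *\<^sub>R y) + ereal (u * (1 - u)) * \<psi> (norm (x - y))
          \<le> ereal u * b x + ereal (1 - u) * b y)"

definition uniformly_convex_rel_gauge ::
  "('a::real_normed_vector \<Rightarrow> ereal) \<Rightarrow> 'a set \<Rightarrow> 'a set \<Rightarrow> (real \<Rightarrow> ereal) \<Rightarrow> bool" where
  "uniformly_convex_rel_gauge b S1 S2 \<psi> \<longleftrightarrow> econvex b \<and>
     S1 \<noteq> {} \<and> S2 \<noteq> {} \<and> S1 \<subseteq> edom b \<and> S2 \<subseteq> edom b \<and> relative_gauge b S1 S2 \<psi>"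

definition uniformly_convex_rel ::
  "('a::real_normed_vector \<Rightarrow> ereal) \<Rightarrow> 'a set \<Rightarrow> 'a set \<Rightarrow> bool" where
  "uniformly_convex_rel b S1 S2 \<longleftrightarrow> (\<exists>\<psi>. uniformly_convex_rel_gauge b S1 S2 \<psi>)"

definition uniformly_convex_on :: "'a::real_normed_vector set \<Rightarrow> ('a \<Rightarrow> ereal) \<Rightarrow> bool" where
  "uniformly_convex_on S b \<longleftrightarrow> uniformly_convex_rel b S S"

definition bregman_div :: "('a::real_normed_vector \<Rightarrow> ereal) \<Rightarrow> 'a \<Rightarrow> 'a \<Rightarrow> ereal" where
  "bregman_div b x y =
     (if x \<in> edom b \<and> y \<in> interior (edom b)
      then b x - b y - ereal (blinfun_apply (gateaux_deriv b y) (x - y)) else \<infinity>)"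

definition bregman_function :: "('a::real_normed_vector \<Rightarrow> ereal) \<Rightarrow> 'a set \<Rightarrow> bool" where
  "bregman_function b U \<longleftrightarrow>
     (U = interior (edom b) \<and> U \<noteq> {} \<and> (\<forall>x\<in>U. gateaux_differentiable b x)) \<and>
     (econvex b \<and> lower_semicontinuous b \<and> strictly_econvex_on (edom b) b) \<and>
     (\<forall>\<gamma>::real. \<forall>x\<in>edom b. bounded {y \<in> U. bregman_div b x y \<le> ereal \<gamma>}) \<and>
     (\<forall>x\<in>edom b. \<forall>y::nat \<Rightarrow> 'a. range y \<subseteq> U \<and> (\<lambda>i. norm (x - y i)) \<longlonglongrightarrow> 0 \<longrightarrow>
        (\<lambda>i. bregman_div b x (y i)) \<longlonglongrightarrow> 0) \<and>
     (\<forall>(x::nat \<Rightarrow> 'a) (y::nat \<Rightarrow> 'a). \<forall>z\<in>edom b.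
        bounded (range x) \<and> range x \<subseteq> edom b \<and> range y \<subseteq> U \<and>
        (\<lambda>i. bregman_div b (x i) (y i)) \<longlonglongrightarrow> 0 \<and> (\<lambda>i. norm (y i - z)) \<longlonglongrightarrow> 0 \<longrightarrow>
        (\<lambda>i. norm (x i - z)) \<longlonglongrightarrow> 0)"

definition sequentially_consistent :: "('a::real_normed_vector \<Rightarrow> ereal) \<Rightarrow> bool" where
  "sequentially_consistent b \<longleftrightarrow>
     (\<forall>(x::nat \<Rightarrow> 'a) (y::nat \<Rightarrow> 'a).
        range x \<subseteq> edom b \<and> range y \<subseteq> interior (edom b) \<and> bounded (range y) \<and>
        (\<lambda>i. bregman_div b (x i) (y i)) \<longlonglongrightarrow> 0 \<longrightarrow>
        (\<lambda>i. norm (x i - y i)) \<longlonglongrightarrow> 0)"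

definition weakly_converges :: "(nat \<Rightarrow> 'a::real_normed_vector) \<Rightarrow> 'a \<Rightarrow> bool" where
  "weakly_converges x l \<longleftrightarrow>
     (\<forall>f::'a \<Rightarrow>\<^sub>L real. (\<lambda>i. blinfun_apply f (x i)) \<longlonglongrightarrow> blinfun_apply f l)"

definition limiting_difference_property :: "('a::real_normed_vector \<Rightarrow> ereal) \<Rightarrow> bool" where
  "limiting_difference_property b \<longleftrightarrow>
     (\<forall>x\<in>edom b. \<forall>(y::nat \<Rightarrow> 'a). \<forall>z\<in>interior (edom b).
        range y \<subseteq> interior (edom b) \<and> weakly_converges y z \<longrightarrow>
        (\<lambda>i. bregman_div b x (y i) - bregman_div b z (y i)) \<longlonglongrightarrow> bregman_div b x z)"

definition weak_to_weak_star_seq_continuous_on ::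
  "'a::real_normed_vector set \<Rightarrow> ('a \<Rightarrow> ('a \<Rightarrow>\<^sub>L real)) \<Rightarrow> bool" where
  "weak_to_weak_star_seq_continuous_on V f \<longleftrightarrow>
     (\<forall>(x::nat \<Rightarrow> 'a). \<forall>l\<in>V. range x \<subseteq> V \<and> weakly_converges x l \<longrightarrow>
        (\<forall>z. (\<lambda>i. blinfun_apply (f (x i)) z) \<longlonglongrightarrow> blinfun_apply (f l) z))"

end

theory Submission
  imports Defs
begin

text \<open>
  Everything rests on one estimate: the divergence dominates a gauge. If
  \<open>b ((x + y)/2) + \<psi> (\<parallel>x - y\<parallel>)/4 \<le> (b x + b y)/2\<close>, then bounding the value at the midpoint
  from below by the tangent at \<open>y\<close> leaves \<open>\<psi> (\<parallel>x - y\<parallel>) \<le> 2 B(x,y)\<close>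
  (\<open>gauge_le_bregman_div\<close>).

  Strict convexity comes from the gauge of \<open>b\<close> on the segment joining the two points.
  With the coercive gauge \<open>\<psi>\<^sub>x\<close> the estimate bounds the sublevel sets of \<open>B(x,\<cdot>)\<close>. For sequential
  consistency the gauge of \<open>b\<close> on a bounded set is needed, but a gauge is only known to be
  positive pointwise, and the first arguments \<open>x\<^sub>i\<close> may be unbounded. Both difficulties
  disappear after pulling \<open>x\<close> along the segment towards \<open>y\<close> until its distance from \<open>y\<close> is
  exactly \<open>\<epsilon>\<close>: by convexity of \<open>B(\<cdot>,y)\<close> the divergence does not increase
  (\<open>bregman_div_segment\<close>), so that \<open>B(x,y) \<ge> \<psi>(\<epsilon>)/2\<close> whenever \<open>\<parallel>x - y\<parallel> \<ge> \<epsilon>\<close> and \<open>y\<close> ranges over a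
  bounded set (\<open>bregman_div_bounded_away\<close>). The last axiom of a Bregman function is then a
  special case of sequential consistency.

  The convergence \<open>B(x,y\<^sub>i) \<rightarrow> 0\<close> for \<open>y\<^sub>i \<rightarrow> x\<close> follows from continuity of \<open>b\<close> on its domain once
  the derivatives \<open>b'(y\<^sub>i)\<close> are known to be bounded; they form a Cauchy sequence, since a
  uniformly continuous map preserves Cauchy sequences. The limiting difference property
  holds because \<open>B(x,y\<^sub>i) - B(z,y\<^sub>i)\<close> depends on \<open>y\<^sub>i\<close> only through \<open>\<langle>b'(y\<^sub>i), x - z\<rangle>\<close>.
\<close>

section \<open>Convexity and the gradient inequality\<close>

lemma ereal_of_proper:
  fixes b :: "'a \<Rightarrow> ereal"
  assumes "\<And>x. b x > -\<infinity>" "x \<in> edom b"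
  shows "b x = ereal (real_of_ereal (b x))"
  using assms(1)[of x] assms(2) by (cases "b x") (auto simp: edom_def)

lemma ereal_of_proper_ex:
  fixes b :: "'a \<Rightarrow> ereal"
  assumes "\<And>x. b x > -\<infinity>" "x \<in> edom b"
  shows "\<exists>r. b x = ereal r"
  using ereal_of_proper[OF assms] by blast

lemma convex_edom:
  assumes "econvex b"
  shows "convex (edom b)"
  unfolding convex_alt
proof (intro ballI allI impI)
  fix x y and u :: real
  assume xy: "x \<in> edom b" "y \<in> edom b" and u: "0 \<le> u \<and> u \<le> 1"
  show "(1 - u) *\<^sub>R x + u *\<^sub>R y \<in> edom b"
  proof (cases "u = 0 \<or> u = 1")
    case True
    then show ?thesis using xy by auto
  next
    case False
    then have "1 - u \<in> {0<..<1}" using u by auto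
    then have "b ((1 - u) *\<^sub>R x + (1 - (1 - u)) *\<^sub>R y)
        \<le> ereal (1 - u) * b x + ereal (1 - (1 - u)) * b y"
      using assms unfolding econvex_def by blast
    also have "\<dots> < \<infinity>"
      using xy u False by (cases "b x"; cases "b y") (auto simp: edom_def)
    finally show ?thesis by (simp add: edom_def)
  qed
qed

lemma econvex_real:
  fixes b :: "'a::real_vector \<Rightarrow> ereal" and u :: real
  assumes "\<And>x. b x > -\<infinity>" "econvex b" "x \<in> edom b" "y \<in> edom b" "0 < u" "u < 1"
  shows "real_of_ereal (b (u *\<^sub>R x + (1 - u) *\<^sub>R y))
    \<le> u * real_of_ereal (b x) + (1 - u) * real_of_ereal (b y)"
proof -
  have "u *\<^sub>R x + (1 - u) *\<^sub>R y \<in> edom b"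
    using convexD[OF convex_edom[OF assms(2)] assms(3,4), of u "1 - u"] assms(5,6) by simp
  then obtain p q r where "b (u *\<^sub>R x + (1 - u) *\<^sub>R y) = ereal p" "b x = ereal q" "b y = ereal r"
    using ereal_of_proper_ex[of b, OF assms(1)] assms(3,4) by meson
  moreover have "b (u *\<^sub>R x + (1 - u) *\<^sub>R y) \<le> ereal u * b x + ereal (1 - u) * b y"
    using assms(2,5,6) unfolding econvex_def by simp
  ultimately show ?thesis by simp
qed

lemma gradient_inequality:
  fixes b :: "'a::real_normed_vector \<Rightarrow> ereal"
  assumes proper: "\<And>x. b x > -\<infinity>" and "econvex b" and l: "has_gateaux_deriv b l y"
    and x: "x \<in> edom b"
  shows "real_of_ereal (b y) + blinfun_apply l (x - y) \<le> real_of_ereal (b x)"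
proof -
  let ?f = "\<lambda>x. real_of_ereal (b x)"
  have y: "y \<in> edom b"
    using l interior_subset unfolding has_gateaux_deriv_def by blast
  have "((\<lambda>t. (b (y + t *\<^sub>R (x - y)) - b y) / ereal t) \<longlongrightarrow> ereal (blinfun_apply l (x - y)))
      (at_right 0)"
    using l unfolding has_gateaux_deriv_def
    by (blast intro: filterlim_at_split[THEN iffD1, THEN conjunct2])
  moreover have "\<forall>\<^sub>F t in at_right 0.
      (b (y + t *\<^sub>R (x - y)) - b y) / ereal t \<le> ereal (?f x - ?f y)"
  proof (rule eventually_at_rightI[of 0 1])
    fix t :: real assume t: "t \<in> {0<..<1}"
    have eq: "y + t *\<^sub>R (x - y) = t *\<^sub>R x + (1 - t) *\<^sub>R y"
      by (simp add: algebra_simps)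
    have in_dom: "y + t *\<^sub>R (x - y) \<in> edom b"
      unfolding eq using convexD[OF convex_edom[OF assms(2)] x y, of t "1 - t"] t by simp
    have "?f (y + t *\<^sub>R (x - y)) \<le> t * ?f x + (1 - t) * ?f y"
      unfolding eq using econvex_real[of b, OF proper assms(2) x y] t by simp
    then have "(?f (y + t *\<^sub>R (x - y)) - ?f y) / t \<le> ?f x - ?f y"
      using t by (simp add: field_simps)
    moreover obtain p q where "b (y + t *\<^sub>R (x - y)) = ereal p" "b y = ereal q"
      using ereal_of_proper_ex[of b, OF proper] in_dom y by meson
    ultimately show "(b (y + t *\<^sub>R (x - y)) - b y) / ereal t \<le> ereal (?f x - ?f y)"
      using t by simp
  qed simp
  ultimately have "ereal (blinfun_apply l (x - y)) \<le> ereal (?f x - ?f y)"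
    by (rule tendsto_upperbound) simp
  then show ?thesis by simp
qed

section \<open>Lower bounds for the divergence\<close>

lemma bregman_div_ereal:
  fixes b :: "'a::real_normed_vector \<Rightarrow> ereal"
  assumes proper: "\<And>x. b x > -\<infinity>" and x: "x \<in> edom b" and y: "y \<in> interior (edom b)"
  shows "bregman_div b x y
    = ereal (real_of_ereal (b x) - real_of_ereal (b y) - blinfun_apply (gateaux_deriv b y) (x - y))"
proof -
  have "y \<in> edom b" using y interior_subset by blast
  then obtain p q where "b x = ereal p" "b y = ereal q"
    using ereal_of_proper_ex[of b, OF proper] x by meson
  then show ?thesis using x y by (simp add: bregman_div_def)
qed

lemma gateaux_deriv_works:
  "gateaux_differentiable b x \<Longrightarrow> has_gateaux_deriv b (gateaux_deriv b x) x"
  unfolding gateaux_differentiable_def by (metis gateaux_deriv_eqI)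

text \<open>
  Letting the weight of \<open>x\<close> tend to \<open>0\<close> instead of using the midpoint would remove the factor \<open>2\<close>,
  but only positivity and growth of the bound matter below.
\<close>

lemma gauge_le_bregman_div:
  fixes b :: "'a::real_normed_vector \<Rightarrow> ereal"
  assumes proper: "\<And>x. b x > -\<infinity>" and "gateaux_differentiable b y"
    and gauge: "uniformly_convex_rel_gauge b S1 S2 \<psi>" and x: "x \<in> S1" and y: "y \<in> S2"
  shows "\<psi> (norm (x - y)) \<le> 2 * bregman_div b x y"
proof -
  let ?f = "\<lambda>x. real_of_ereal (b x)" and ?l = "gateaux_deriv b y"
  let ?m = "(1/2) *\<^sub>R x + (1/2) *\<^sub>R y"
  have cvx: "econvex b" and dom: "x \<in> edom b" "y \<in> edom b"
    using gauge x y unfolding uniformly_convex_rel_gauge_def by blast+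
  have l: "has_gateaux_deriv b ?l y"
    using assms(2) by (rule gateaux_deriv_works)
  have yU: "y \<in> interior (edom b)"
    using l unfolding has_gateaux_deriv_def by blast
  have m: "?m \<in> edom b"
    using convexD[OF convex_edom[OF cvx] dom, of "1/2" "1/2"] by simp
  have "?f y + ?l (?m - y) \<le> ?f ?m"
    by (rule gradient_inequality[of b, OF proper cvx l m])
  moreover have "?m - y = (1/2) *\<^sub>R (x - y)"
    by (simp add: algebra_simps flip: scaleR_add_left)
  ultimately have tangent: "?f y + ?l (x - y) / 2 \<le> ?f ?m"
    by (simp add: blinfun.scaleR_right)
  have half: "1/2 \<in> {0<..<1::real}" by simp
  have midpoint: "b ?m + ereal (1/4) * \<psi> (norm (x - y)) \<le> ereal (1/2) * b x + ereal (1/2) * b y"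
    using gauge half x y unfolding uniformly_convex_rel_gauge_def relative_gauge_def by fastforce
  obtain p q r where pqr: "b ?m = ereal p" "b x = ereal q" "b y = ereal r"
    using ereal_of_proper_ex[of b, OF proper] dom m by meson
  show ?thesis
    using midpoint tangent pqr unfolding bregman_div_ereal[of b, OF proper dom(1) yU]
    by (cases "\<psi> (norm (x - y))") (auto simp: field_simps)
qed

lemma bregman_div_segment:
  fixes b :: "'a::real_normed_vector \<Rightarrow> ereal"
  assumes proper: "\<And>x. b x > -\<infinity>" and cvx: "econvex b" and y: "gateaux_differentiable b y"
    and x: "x \<in> edom b" and s: "0 < s" "s \<le> 1"
  shows "bregman_div b (y + s *\<^sub>R (x - y)) y \<le> bregman_div b x y"
proof (cases "s = 1")
  case False
  let ?f = "\<lambda>x. real_of_ereal (b x)" and ?l = "gateaux_deriv b y"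
  have l: "has_gateaux_deriv b ?l y" using y by (rule gateaux_deriv_works)
  then have yU: "y \<in> interior (edom b)" unfolding has_gateaux_deriv_def by blast
  then have yd: "y \<in> edom b" using interior_subset by blast
  have eq: "y + s *\<^sub>R (x - y) = s *\<^sub>R x + (1 - s) *\<^sub>R y"
    by (simp add: algebra_simps)
  have dom: "y + s *\<^sub>R (x - y) \<in> edom b"
    unfolding eq using convexD[OF convex_edom[OF cvx] x yd, of s "1 - s"] s by simp
  have "?f (y + s *\<^sub>R (x - y)) \<le> s * ?f x + (1 - s) * ?f y"
    unfolding eq using econvex_real[of b, OF proper cvx x yd] s False by simp
  then have "?f (y + s *\<^sub>R (x - y)) - ?f y - s * ?l (x - y) \<le> s * (?f x - ?f y - ?l (x - y))"
    by (simp add: algebra_simps)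
  also have "\<dots> \<le> 1 * (?f x - ?f y - ?l (x - y))"
    using s gradient_inequality[of b, OF proper cvx l x] by (intro mult_right_mono) auto
  finally show ?thesis
    unfolding bregman_div_ereal[of b, OF proper dom yU] bregman_div_ereal[of b, OF proper x yU]
    by (simp add: blinfun.scaleR_right)
qed simp

text \<open>
  Moving \<open>x\<close> towards \<open>y\<close> to distance exactly \<open>\<epsilon>\<close> does not raise the divergence and confines both points to
  one bounded convex set, whose gauge need be evaluated only at \<open>\<epsilon>\<close>.
\<close>

lemma bregman_div_bounded_away:
  fixes b :: "'a::real_normed_vector \<Rightarrow> ereal"
  assumes proper: "\<And>x. b x > -\<infinity>" and cvx: "econvex b"
    and diff: "\<And>y. y \<in> Y \<Longrightarrow> gateaux_differentiable b y"
    and uconvex: "\<And>S. S \<noteq> {} \<Longrightarrow> bounded S \<Longrightarrow> convex S \<Longrightarrow> S \<subseteq> edom b \<Longrightarrow> uniformly_convex_on S b"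
    and Y: "bounded Y" and \<epsilon>: "\<epsilon> > 0"
  obtains c :: real where "c > 0"
    "\<And>x y. x \<in> edom b \<Longrightarrow> y \<in> Y \<Longrightarrow> \<epsilon> \<le> norm (x - y) \<Longrightarrow> ereal c \<le> bregman_div b x y"
proof (cases "Y = {}")
  case True
  then show ?thesis using that[of 1] by simp
next
  case False
  have Ysub: "Y \<subseteq> edom b"
    using gateaux_deriv_works[OF diff] interior_subset unfolding has_gateaux_deriv_def by blast
  obtain R where R: "\<And>y. y \<in> Y \<Longrightarrow> norm y \<le> R"
    using Y unfolding bounded_iff by blast
  let ?S = "edom b \<inter> cball 0 (R + \<epsilon>)"
  have YS: "Y \<subseteq> ?S" using R \<epsilon> Ysub by fastforce
  have "uniformly_convex_on ?S b"
  proof (rule uconvex)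
    show "?S \<noteq> {}" using YS False by blast
    show "convex ?S" by (intro convex_Int convex_edom[OF cvx] convex_cball)
  qed (auto intro: bounded_Int)
  then obtain \<psi> where \<psi>: "uniformly_convex_rel_gauge b ?S ?S \<psi>"
    unfolding uniformly_convex_on_def uniformly_convex_rel_def by blast
  then have "0 < \<psi> \<epsilon>"
    using \<epsilon> unfolding uniformly_convex_rel_gauge_def relative_gauge_def by blast
  then obtain c where c: "0 < ereal c" "ereal c < \<psi> \<epsilon>"
    using ereal_dense2 by blast
  show ?thesis
  proof (rule that[of "c / 2"])
    show "c / 2 > 0" using c by simp
    fix x y assume x: "x \<in> edom b" and y: "y \<in> Y" and far: "\<epsilon> \<le> norm (x - y)"
    define s where "s = \<epsilon> / norm (x - y)"
    define x' where "x' = y + s *\<^sub>R (x - y)"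
    have pos: "0 < norm (x - y)" using far \<epsilon> by linarith
    then have s: "0 < s" "s \<le> 1" using far \<epsilon> by (simp_all add: s_def)
    have dist: "norm (x' - y) = \<epsilon>" using pos \<epsilon> by (simp add: x'_def s_def)
    have "x' = s *\<^sub>R x + (1 - s) *\<^sub>R y" by (simp add: x'_def algebra_simps)
    then have x'_dom: "x' \<in> edom b"
      using convexD[OF convex_edom[OF cvx] x, of y s "1 - s"] y Ysub s by auto
    moreover have "norm x' \<le> R + \<epsilon>"
      using norm_triangle_sub[of x' y] dist R[OF y] by simp
    ultimately have "x' \<in> ?S" by simp
    moreover have "y \<in> ?S" using y YS by blast
    ultimately have "\<psi> (norm (x' - y)) \<le> 2 * bregman_div b x' y"
      by (rule gauge_le_bregman_div[of b, OF proper diff[OF y] \<psi>])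
    then have "\<psi> \<epsilon> \<le> 2 * bregman_div b x' y"
      unfolding dist .
    with c have "ereal c \<le> 2 * bregman_div b x' y" by order
    then have "ereal (c / 2) \<le> bregman_div b x' y"
      by (cases "bregman_div b x' y") auto
    also have "\<dots> \<le> bregman_div b x y"
      unfolding x'_def by (rule bregman_div_segment[of b, OF proper cvx diff[OF y] x s])
    finally show "ereal (c / 2) \<le> bregman_div b x y" .
  qed
qed

section \<open>Bregman properties\<close>

lemma sequentially_consistent_if_uniformly_convex_on_bounded:
  fixes b :: "'a::real_normed_vector \<Rightarrow> ereal"
  assumes proper: "\<And>x. b x > -\<infinity>" and cvx: "econvex b"
    and diff: "\<And>y. y \<in> interior (edom b) \<Longrightarrow> gateaux_differentiable b y"
    and uconvex: "\<And>S. S \<noteq> {} \<Longrightarrow> bounded S \<Longrightarrow> convex S \<Longrightarrow> S \<subseteq> edom b \<Longrightarrow> uniformly_convex_on S b"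
  shows "sequentially_consistent b"
  unfolding sequentially_consistent_def
proof (intro allI impI)
  fix x y :: "nat \<Rightarrow> 'a"
  assume A: "range x \<subseteq> edom b \<and> range y \<subseteq> interior (edom b) \<and> bounded (range y) \<and>
    (\<lambda>i. bregman_div b (x i) (y i)) \<longlonglongrightarrow> 0"
  show "(\<lambda>i. norm (x i - y i)) \<longlonglongrightarrow> 0"
  proof (rule order_tendstoI)
    fix \<epsilon> :: real assume \<epsilon>: "0 < \<epsilon>"
    have diff': "\<And>z. z \<in> range y \<Longrightarrow> gateaux_differentiable b z"
      using A diff by blast
    have bdd: "bounded (range y)" using A by blast
    obtain c :: real where c: "c > 0"
      "\<And>u v. u \<in> edom b \<Longrightarrow> v \<in> range y \<Longrightarrow> \<epsilon> \<le> norm (u - v) \<Longrightarrow> ereal c \<le> bregman_div b u v"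
      using proper cvx diff' uconvex bdd \<epsilon> by (rule bregman_div_bounded_away) blast+
    have "\<forall>\<^sub>F i in sequentially. bregman_div b (x i) (y i) < ereal c"
      using A c(1) by (auto intro: order_tendstoD(2))
    then show "\<forall>\<^sub>F i in sequentially. norm (x i - y i) < \<epsilon>"
    proof eventually_elim
      case (elim i)
      show ?case
      proof (rule ccontr)
        assume "\<not> norm (x i - y i) < \<epsilon>"
        then have "ereal c \<le> bregman_div b (x i) (y i)"
          using A by (intro c(2)) auto
        with elim show False by simp
      qed
    qed
  qed (auto intro!: always_eventually order.strict_trans2[OF _ norm_ge_zero])
qed

lemma strictly_econvex_on_if_uniformly_convex_on_bounded:
  fixes b :: "'a::real_normed_vector \<Rightarrow> ereal"
  assumes proper: "\<And>x. b x > -\<infinity>" and cvx: "econvex b"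
    and uconvex: "\<And>S. S \<noteq> {} \<Longrightarrow> bounded S \<Longrightarrow> convex S \<Longrightarrow> S \<subseteq> edom b \<Longrightarrow> uniformly_convex_on S b"
  shows "strictly_econvex_on (edom b) b"
  unfolding strictly_econvex_on_def
proof (intro ballI impI)
  fix x y and u :: real
  assume x: "x \<in> edom b" and y: "y \<in> edom b" and u: "u \<in> {0<..<1}" and "x \<noteq> y"
  let ?S = "closed_segment x y"
  have "uniformly_convex_on ?S b"
    using closed_segment_subset[OF x y convex_edom[OF cvx]] by (intro uconvex) (auto simp: bounded_closed_segment)
  then obtain \<psi> where "uniformly_convex_rel_gauge b ?S ?S \<psi>"
    unfolding uniformly_convex_on_def uniformly_convex_rel_def by blast
  then have \<psi>: "relative_gauge b ?S ?S \<psi>"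
    unfolding uniformly_convex_rel_gauge_def by blast
  have pos: "0 < \<psi> (norm (x - y))"
    using \<psi> \<open>x \<noteq> y\<close> unfolding relative_gauge_def by simp
  have le: "b (u *\<^sub>R x + (1 - u) *\<^sub>R y) + ereal (u * (1 - u)) * \<psi> (norm (x - y))
      \<le> ereal u * b x + ereal (1 - u) * b y"
    using \<psi> u unfolding relative_gauge_def by (meson ends_in_segment)
  have "u *\<^sub>R x + (1 - u) *\<^sub>R y \<in> edom b"
    using convexD[OF convex_edom[OF cvx] x y, of u "1 - u"] u by simp
  then obtain p q r where pqr: "b (u *\<^sub>R x + (1 - u) *\<^sub>R y) = ereal p" "b x = ereal q" "b y = ereal r"
    using ereal_of_proper_ex[of b, OF proper] x y by meson
  have "0 < u * (1 - u)" using u by simp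
  then have "0 < ereal (u * (1 - u)) * \<psi> (norm (x - y))"
    using pos by (simp add: ereal_zero_less_0_iff)
  then show "b (u *\<^sub>R x + (1 - u) *\<^sub>R y) < ereal u * b x + ereal (1 - u) * b y"
    using le unfolding pqr by (cases "ereal (u * (1 - u)) * \<psi> (norm (x - y))") auto
qed

lemma bounded_bregman_sublevel:
  fixes b :: "'a::real_normed_vector \<Rightarrow> ereal"
  assumes proper: "\<And>x. b x > -\<infinity>"
    and diff: "\<And>y. y \<in> U \<Longrightarrow> gateaux_differentiable b y"
    and gauge: "uniformly_convex_rel_gauge b {x} (U \<inter> {w. norm w \<ge> r}) \<psi>"
    and coercive: "(\<psi> \<longlongrightarrow> \<infinity>) at_top"
  shows "bounded {y \<in> U. bregman_div b x y \<le> ereal \<gamma>}"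
proof -
  have "\<forall>\<^sub>F t in at_top. ereal (2 * \<gamma>) < \<psi> t"
    using coercive by (rule order_tendstoD(1)) simp
  then obtain T where T: "\<And>t. T \<le> t \<Longrightarrow> ereal (2 * \<gamma>) < \<psi> t"
    unfolding eventually_at_top_linorder by blast
  have "norm y \<le> max r (norm x + T)" if "y \<in> U" "bregman_div b x y \<le> ereal \<gamma>" for y
  proof (cases "norm y \<ge> r")
    case True
    have "\<psi> (norm (x - y)) \<le> 2 * bregman_div b x y"
      using gauge_le_bregman_div[of b, OF proper diff gauge] that True by simp
    also have "\<dots> \<le> ereal (2 * \<gamma>)"
      using that(2) by (cases "bregman_div b x y") auto
    finally have "norm (x - y) < T" using T by (meson not_le)
    then show ?thesis using norm_triangle_sub[of y x] by (simp add: norm_minus_commute)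
  qed simp
  then show ?thesis unfolding bounded_iff by blast
qed

lemma bregman_div_tendsto_0:
  fixes b :: "'a::real_normed_vector \<Rightarrow> ereal" and y :: "nat \<Rightarrow> 'a"
  assumes proper: "\<And>x. b x > -\<infinity>" and cvx: "econvex b" and cont: "continuous_on (edom b) b"
    and ucont: "\<And>S. S \<noteq> {} \<Longrightarrow> bounded S \<Longrightarrow> convex S \<Longrightarrow> S \<subseteq> interior (edom b) \<Longrightarrow>
                  uniformly_continuous_on S (gateaux_deriv b)"
    and x: "x \<in> edom b" and y: "range y \<subseteq> interior (edom b)" and lim: "y \<longlonglongrightarrow> x"
  shows "(\<lambda>i. bregman_div b x (y i)) \<longlonglongrightarrow> 0"
proof -
  let ?f = "\<lambda>x. real_of_ereal (b x)"
  let ?S = "convex hull range y"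
  have y_dom: "y i \<in> edom b" for i using y interior_subset by blast
  have "(\<lambda>i. b (y i)) \<longlonglongrightarrow> b x"
    using continuous_on_tendsto_compose[OF cont lim x] y_dom by simp
  then have f_lim: "(\<lambda>i. ?f (y i)) \<longlonglongrightarrow> ?f x"
    by (subst (asm) ereal_of_proper[of b, OF proper x]) (rule lim_real_of_ereal)
  \<comment> \<open>The limit \<open>x\<close> may be a boundary point, where \<open>b'\<close> does not exist; hence the argument by Cauchy
    sequences, on a bounded convex set inside the interior.\<close>
  have "uniformly_continuous_on ?S (gateaux_deriv b)"
  proof (rule ucont)
    show "bounded ?S" using lim by (intro bounded_convex_hull convergent_imp_bounded)
    show "?S \<subseteq> interior (edom b)"
      using y convex_interior[OF convex_edom[OF cvx]] by (rule hull_minimal)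
  qed auto
  then have "Cauchy (\<lambda>i. gateaux_deriv b (y i))"
    using LIMSEQ_imp_Cauchy[OF lim] by (rule uniformly_continuous_on_Cauchy) (simp add: hull_inc)
  then have "Bseq (\<lambda>i. gateaux_deriv b (y i))"
    by (rule Cauchy_Bseq)
  moreover have "Zfun (\<lambda>i. x - y i) sequentially"
    using tendsto_diff[OF tendsto_const lim, of x] by (simp add: tendsto_Zfun_iff)
  ultimately have "Zfun (\<lambda>i. gateaux_deriv b (y i) (x - y i)) sequentially"
    using bounded_bilinear.Bfun_prod_Zfun[OF bounded_bilinear_blinfun_apply] by blast
  then have "(\<lambda>i. gateaux_deriv b (y i) (x - y i)) \<longlonglongrightarrow> 0"
    by (simp add: tendsto_Zfun_iff)
  then have "(\<lambda>i. ?f x - ?f (y i) - gateaux_deriv b (y i) (x - y i)) \<longlonglongrightarrow> 0"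
    using tendsto_diff[OF tendsto_diff[OF tendsto_const[of "?f x"] f_lim]] by fastforce
  then have "(\<lambda>i. ereal (?f x - ?f (y i) - gateaux_deriv b (y i) (x - y i))) \<longlonglongrightarrow> ereal 0"
    by (rule tendsto_ereal)
  moreover have "bregman_div b x (y i)
      = ereal (?f x - ?f (y i) - gateaux_deriv b (y i) (x - y i))" for i
    using bregman_div_ereal[of b, OF proper x] y by blast
  ultimately show ?thesis by (simp add: zero_ereal_def)
qed

lemma bregman_function_if_uniformly_convex:
  fixes b :: "'a::real_normed_vector \<Rightarrow> ereal" and U :: "'a set"
  assumes proper: "\<And>x. b x > -\<infinity>"
    and convex: "econvex b"
    and lsc: "lower_semicontinuous b"
    and cont: "continuous_on (edom b) b"
    and U: "U = interior (edom b)" "U \<noteq> {}"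
    and diff: "\<And>x. x \<in> U \<Longrightarrow> gateaux_differentiable b x"
    and uconvex: "\<And>S. S \<noteq> {} \<Longrightarrow> bounded S \<Longrightarrow> convex S \<Longrightarrow> S \<subseteq> edom b \<Longrightarrow> uniformly_convex_on S b"
    and ucont: "\<And>S. S \<noteq> {} \<Longrightarrow> bounded S \<Longrightarrow> convex S \<Longrightarrow> S \<subseteq> U \<Longrightarrow>
                  uniformly_continuous_on S (gateaux_deriv b)"
    and coercive: "\<And>x. x \<in> edom b \<Longrightarrow>
                  \<exists>r\<ge>0. \<exists>\<psi>. uniformly_convex_rel_gauge b {x} (U \<inter> {w. norm w \<ge> r}) \<psi> \<and>
                    (\<psi> \<longlongrightarrow> \<infinity>) at_top"
  shows "bregman_function b U"
proof -
  have seq: "sequentially_consistent b"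
    using proper convex diff[unfolded U(1)] uconvex
    by (rule sequentially_consistent_if_uniformly_convex_on_bounded)
  have "bounded {y \<in> U. bregman_div b x y \<le> ereal \<gamma>}" if "x \<in> edom b" for x \<gamma>
    using coercive[OF that] bounded_bregman_sublevel[of b, OF proper diff] by blast
  moreover have "(\<lambda>i. bregman_div b x (y i)) \<longlonglongrightarrow> 0"
    if "x \<in> edom b" "range y \<subseteq> U" "(\<lambda>i. norm (x - y i)) \<longlonglongrightarrow> 0" for x and y :: "nat \<Rightarrow> 'a"
  proof -
    have "(\<lambda>i. norm (y i - x)) \<longlonglongrightarrow> 0"
      using that(3) by (simp add: norm_minus_commute)
    then have "y \<longlonglongrightarrow> x"
      by (rule LIM_zero_cancel[OF tendsto_norm_zero_cancel])
    then show ?thesis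
      using proper convex cont ucont[unfolded U(1)] that(1) that(2)[unfolded U(1)]
      by (intro bregman_div_tendsto_0)
  qed
  moreover have "(\<lambda>i. norm (x i - z)) \<longlonglongrightarrow> 0"
    if "bounded (range x) \<and> range x \<subseteq> edom b \<and> range y \<subseteq> U \<and>
        (\<lambda>i. bregman_div b (x i) (y i)) \<longlonglongrightarrow> 0 \<and> (\<lambda>i. norm (y i - z)) \<longlonglongrightarrow> 0" for x y :: "nat \<Rightarrow> 'a" and z
  proof -
    have yz: "(\<lambda>i. norm (y i - z)) \<longlonglongrightarrow> 0" using that by blast
    then have "y \<longlonglongrightarrow> z" by (rule LIM_zero_cancel[OF tendsto_norm_zero_cancel])
    then have "bounded (range y)" by (rule convergent_imp_bounded)
    then have "(\<lambda>i. norm (x i - y i)) \<longlonglongrightarrow> 0"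
      using seq that unfolding sequentially_consistent_def U(1) by simp
    then have "(\<lambda>i. (x i - y i) + (y i - z)) \<longlonglongrightarrow> 0 + 0"
      using yz by (intro tendsto_add) (simp_all add: tendsto_norm_zero_iff)
    then show ?thesis by (simp add: tendsto_norm_zero_iff)
  qed
  moreover have "strictly_econvex_on (edom b) b"
    using proper convex uconvex by (rule strictly_econvex_on_if_uniformly_convex_on_bounded)
  ultimately show ?thesis
    unfolding bregman_function_def using U diff convex lsc by (intro conjI allI ballI impI) simp_all
qed

lemma limiting_difference_property_if_weak_to_weak_star:
  fixes b :: "'a::real_normed_vector \<Rightarrow> ereal"
  assumes proper: "\<And>x. b x > -\<infinity>"
    and weak: "weak_to_weak_star_seq_continuous_on (interior (edom b)) (gateaux_deriv b)"
  shows "limiting_difference_property b"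
  unfolding limiting_difference_property_def
proof safe
  fix x z and y :: "nat \<Rightarrow> 'a"
  assume x: "x \<in> edom b" and z: "z \<in> interior (edom b)"
    and y: "range y \<subseteq> interior (edom b)" "weakly_converges y z"
  let ?f = "\<lambda>x. real_of_ereal (b x)"
  have zd: "z \<in> edom b" using z interior_subset by blast
  have "(\<lambda>i. gateaux_deriv b (y i) (x - z)) \<longlonglongrightarrow> gateaux_deriv b z (x - z)"
    using weak y z unfolding weak_to_weak_star_seq_continuous_on_def by blast
  then have "(\<lambda>i. ereal (?f x - ?f z - gateaux_deriv b (y i) (x - z)))
      \<longlonglongrightarrow> ereal (?f x - ?f z - gateaux_deriv b z (x - z))"
    by (intro tendsto_ereal tendsto_diff tendsto_const)
  moreover have "bregman_div b x (y i) - bregman_div b z (y i)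
      = ereal (?f x - ?f z - gateaux_deriv b (y i) (x - z))" for i
  proof -
    have "y i \<in> interior (edom b)" using y by blast
    then show ?thesis
      by (simp add: bregman_div_ereal[of b, OF proper x] bregman_div_ereal[of b, OF proper zd] blinfun.diff_right)
  qed
  ultimately show "(\<lambda>i. bregman_div b x (y i) - bregman_div b z (y i)) \<longlonglongrightarrow> bregman_div b x z"
    by (simp add: bregman_div_ereal[of b, OF proper x z])
qed

theorem corollary4p14:
  fixes b :: "'a::real_normed_vector \<Rightarrow> ereal" and U :: "'a set"
  assumes nontrivial: "\<exists>x::'a. x \<noteq> 0"
    and proper: "\<And>x. b x > -\<infinity>"
    and convex: "econvex b"
    and lsc: "lower_semicontinuous b"
    and cont: "continuous_on (edom b) b"
    and U: "U = interior (edom b)" "U \<noteq> {}"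
    and diff: "\<And>x. x \<in> U \<Longrightarrow> gateaux_differentiable b x"
    and uconvex: "\<And>S. S \<noteq> {} \<Longrightarrow> bounded S \<Longrightarrow> convex S \<Longrightarrow> S \<subseteq> edom b \<Longrightarrow> uniformly_convex_on S b"
    and ucont: "\<And>S. S \<noteq> {} \<Longrightarrow> bounded S \<Longrightarrow> convex S \<Longrightarrow> S \<subseteq> U \<Longrightarrow>
                  uniformly_continuous_on S (gateaux_deriv b)"
    and coercive: "\<And>x. x \<in> edom b \<Longrightarrow>
                  \<exists>r\<ge>0. \<exists>\<psi>. uniformly_convex_rel_gauge b {x} (U \<inter> {w. norm w \<ge> r}) \<psi> \<and>
                    (\<psi> \<longlongrightarrow> \<infinity>) at_top"
  shows "bregman_function b U \<and> sequentially_consistent b \<and>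
         (weak_to_weak_star_seq_continuous_on U (gateaux_deriv b) \<longrightarrow>
            limiting_difference_property b)"
proof (intro conjI impI)
  show "bregman_function b U"
    using proper convex lsc cont U diff uconvex ucont coercive
    by (rule bregman_function_if_uniformly_convex)
  show "sequentially_consistent b"
    using proper convex diff[unfolded U(1)] uconvex
    by (rule sequentially_consistent_if_uniformly_convex_on_bounded)
  assume "weak_to_weak_star_seq_continuous_on U (gateaux_deriv b)"
  with proper show "limiting_difference_property b"
    unfolding U(1) by (rule limiting_difference_property_if_weak_to_weak_star)
qed

end
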